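(* The following equalities between forgetful projections of justification logics and modal logics hold. (1) $\mathsf{J}^\circ=\mathsf{K}$, $\mathsf{JT}^\circ=\mathsf{T}$, $\mathsf{JD}^\circ=\mathsf{D}$, $\mathsf{J4}^\circ=\mathsf{K4}$, $\mathsf{J5}^\circ=\mathsf{K5}$, $\mathsf{JD5}^\circ=\mathsf{D5}$, $\mathsf{JD4}^\circ=\mathsf{D4}$, $\mathsf{J45}^\circ=\mathsf{K45}$, $\mathsf{JD45}^\circ=\mathsf{D45}$, $\mathsf{LP}^\circ=\mathsf{S4}$, $\mathsf{JT5}^\circ=\mathsf{JT45}^\circ=\mathsf{S5}$. (2) $\mathsf{JB}^\circ=\mathsf{KB}$, $\mathsf{JTB}^\circ=\mathsf{TB}$, $\mathsf{JDB}^\circ=\mathsf{DB}$, $\mathsf{JB4}^\circ=\mathsf{JB5}^\circ=\mathsf{JB45}^\circ=\mathsf{KB5}$, $\mathsf{JTB5}^\circ=\mathsf{JDB5}^\circ=\mathsf{JTB45}^\circ=\mathsf{JDB45}^\circ=\mathsf{JTB4}^\circ=\mathsf{JDB4}^\circ=\mathsf{S5}$. Moreover, all the realization results of (1) and (2) are normal realizations: for each of these equalities $\mathsf{JL}^\circ=\mathsf{ML}$ and each theorem $F$ of $\mathsf{ML}$ there is a normal $\mathsf{JL}$-realization $F^r$ of $F$ that is a theorem of $\mathsf{JL}$.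
   Context: Modal logics. Modal formulas are built from propositional variables and $\bot$ by $\neg,\wedge,\vee,\to,\Box$. $\mathsf K$ has as axioms all propositional tautologies and $\Box(A\to B)\to(\Box A\to\Box B)$, with rules Modus Ponens and Necessitation (from $\vdash A$ infer $\vdash\Box A$). Further schemes: (T) $\Box A\to A$; (D) $\Box\bot\to\bot$; (4) $\Box A\to\Box\Box A$; (B) $\neg A\to\Box\neg\Box A$; (5) $\neg\Box A\to\Box\neg\Box A$. The name of each modal logic lists the schemes added to $\mathsf K$ (e.g. $\mathsf{KB5}$ adds B and 5; $\mathsf{T},\mathsf{D},\mathsf{D4},\mathsf{D5},\mathsf{D45},\mathsf{DB},\mathsf{TB}$ add the named schemes), with $\mathsf{S4}=\mathsf{KT4}$ and $\mathsf{S5}=\mathsf{KT45}$. Justification logics. Justification terms are built from justification variables and justification constants by binary operations $\cdot,+$ and (depending on the logic) unary operations $!$, $?$, $\bar{?}$. Justification formulas are built from propositional variables and $\bot$ by $\neg,\wedge,\vee,\to$ and the construction $t:A$ ($t$ a term). $\mathsf J$ has axiom schemes: all propositional tautologies; $s:A\to(s+t):A$ and $s:A\to(t+s):A$; $s:(A\to B)\to(t:A\to(s\cdot t):B)$. Further schemes: (jT) $t:A\to A$; (jD) $t:\bot\to\bot$; (j4) $t:A\to\,!t:t:A$; (jB) $\neg A\to\bar{?}t:\neg t:A$; (j5) $\neg t:A\to\,?t:\neg t:A$. The name of each justification logic lists the schemes added to $\mathsf J$, with $\mathsf{LP}=\mathsf{JT4}$. The language contains $!$ (resp. $\bar{?}$,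 $?$) exactly when (j4) (resp. (jB), (j5)) is an axiom. The rules are Modus Ponens and: if (j4) is an axiom, infer $c:A$ for every axiom instance $A$ and every constant $c$; if (j4) is not an axiom, infer $c_n:c_{n-1}:\dots:c_1:A$ for every axiom instance $A$, all constants $c_1,\dots,c_n$ and all $n\ge1$. A logic is identified with its set of theorems. The forgetful projection $F^\circ$ of a justification formula is the modal formula given by $P^\circ=P$, $\bot^\circ=\bot$, $(\neg A)^\circ=\neg A^\circ$, $(A\star B)^\circ=A^\circ\star B^\circ$ for binary connectives $\star$, and $(t:A)^\circ=\Box A^\circ$. $\mathsf{JL}^\circ=\{F^\circ\mid F\text{ is a theorem of }\mathsf{JL}\}$. A $\mathsf{JL}$-realization $F^r$ of a modal formula $F$ is a formula of $\mathsf{JL}$ obtained by replacing every occurrence of $\Box$ in $F$ by a justification term of $\mathsf{JL}$ (i.e. replacing $\Box B$ by $t:B$); it is normal if all negative occurrences of $\Box$ are replaced by distinct justification variables. *)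

theory Defs
  imports Main
begin

text \<open>A logic is named by the set of schemes added to the basic system: K on the modal side,
  J on the justification side. The same label stands for (T) and (jT), and so on.\<close>

datatype scheme = AxT | AxD | Ax4 | AxB | Ax5


section \<open>Modal logics\<close>

datatype mfml =
    MVar nat
  | MBot
  | MNeg mfml
  | MAnd mfml mfml
  | MOr mfml mfml
  | MImp mfml mfml
  | Box mfml

text \<open>Propositional variables and boxed formulas are the atoms of the propositional evaluation, so
  that the tautologies include all modal instances of classical tautologies.\<close>

primrec meval :: "(mfml \<Rightarrow> bool) \<Rightarrow> mfml \<Rightarrow> bool" where
  "meval v (MVar p) = v (MVar p)"
| "meval v MBot = False"
| "meval v (MNeg A) = (\<not> meval v A)"
| "meval v (MAnd A B) = (meval v A \<and> meval v B)"
| "meval v (MOr A B) = (meval v A \<or> meval v B)"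
| "meval v (MImp A B) = (meval v A \<longrightarrow> meval v B)"
| "meval v (Box A) = v (Box A)"

definition mtaut :: "mfml \<Rightarrow> bool" where
  "mtaut A \<longleftrightarrow> (\<forall>v. meval v A)"

inductive maxiom :: "scheme set \<Rightarrow> mfml \<Rightarrow> bool" for S where
  taut: "mtaut A \<Longrightarrow> maxiom S A"
| K: "maxiom S (MImp (Box (MImp A B)) (MImp (Box A) (Box B)))"
| T: "AxT \<in> S \<Longrightarrow> maxiom S (MImp (Box A) A)"
| D: "AxD \<in> S \<Longrightarrow> maxiom S (MImp (Box MBot) MBot)"
| Four: "Ax4 \<in> S \<Longrightarrow> maxiom S (MImp (Box A) (Box (Box A)))"
| B: "AxB \<in> S \<Longrightarrow> maxiom S (MImp (MNeg A) (Box (MNeg (Box A))))"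
| Five: "Ax5 \<in> S \<Longrightarrow> maxiom S (MImp (MNeg (Box A)) (Box (MNeg (Box A))))"

inductive_set ModL :: "scheme set \<Rightarrow> mfml set" for S where
  axiom: "maxiom S A \<Longrightarrow> A \<in> ModL S"
| mp: "MImp A B \<in> ModL S \<Longrightarrow> A \<in> ModL S \<Longrightarrow> B \<in> ModL S"
| nec: "A \<in> ModL S \<Longrightarrow> Box A \<in> ModL S"

abbreviation S4 :: "mfml set" where "S4 \<equiv> ModL {AxT, Ax4}"
abbreviation S5 :: "mfml set" where "S5 \<equiv> ModL {AxT, Ax4, Ax5}"


section \<open>Justification logics\<close>

datatype trm =
    TVar nat
  | TConst nat
  | App trm trm
  | Sum trm trm
  | Bang trm     \<comment> \<open>written \<open>!t\<close>, belongs to (j4)\<close>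
  | BarQ trm     \<comment> \<open>barred question mark, belongs to (jB)\<close>
  | Quest trm    \<comment> \<open>written \<open>?t\<close>, belongs to (j5)\<close>

datatype jfml =
    JVar nat
  | JBot
  | JNeg jfml
  | JAnd jfml jfml
  | JOr jfml jfml
  | JImp jfml jfml
  | Just trm jfml

text \<open>The types provide all operations; the language of the justification logic named by \<open>S\<close> is cut
  out by the following two predicates.\<close>

primrec trm_of :: "scheme set \<Rightarrow> trm \<Rightarrow> bool" where
  "trm_of S (TVar x) = True"
| "trm_of S (TConst c) = True"
| "trm_of S (App s t) = (trm_of S s \<and> trm_of S t)"
| "trm_of S (Sum s t) = (trm_of S s \<and> trm_of S t)"
| "trm_of S (Bang t) = (Ax4 \<in> S \<and> trm_of S t)"
| "trm_of S (BarQ t) = (AxB \<in> S \<and> trm_of S t)"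
| "trm_of S (Quest t) = (Ax5 \<in> S \<and> trm_of S t)"

primrec jfml_of :: "scheme set \<Rightarrow> jfml \<Rightarrow> bool" where
  "jfml_of S (JVar p) = True"
| "jfml_of S JBot = True"
| "jfml_of S (JNeg A) = jfml_of S A"
| "jfml_of S (JAnd A B) = (jfml_of S A \<and> jfml_of S B)"
| "jfml_of S (JOr A B) = (jfml_of S A \<and> jfml_of S B)"
| "jfml_of S (JImp A B) = (jfml_of S A \<and> jfml_of S B)"
| "jfml_of S (Just t A) = (trm_of S t \<and> jfml_of S A)"

primrec jeval :: "(jfml \<Rightarrow> bool) \<Rightarrow> jfml \<Rightarrow> bool" where
  "jeval v (JVar p) = v (JVar p)"
| "jeval v JBot = False"
| "jeval v (JNeg A) = (\<not> jeval v A)"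
| "jeval v (JAnd A B) = (jeval v A \<and> jeval v B)"
| "jeval v (JOr A B) = (jeval v A \<or> jeval v B)"
| "jeval v (JImp A B) = (jeval v A \<longrightarrow> jeval v B)"
| "jeval v (Just t A) = v (Just t A)"

definition jtaut :: "jfml \<Rightarrow> bool" where
  "jtaut A \<longleftrightarrow> (\<forall>v. jeval v A)"

inductive jscheme :: "scheme set \<Rightarrow> jfml \<Rightarrow> bool" for S where
  taut: "jtaut A \<Longrightarrow> jscheme S A"
| sumL: "jscheme S (JImp (Just s A) (Just (Sum s t) A))"
| sumR: "jscheme S (JImp (Just s A) (Just (Sum t s) A))"
| app: "jscheme S (JImp (Just s (JImp A B)) (JImp (Just t A) (Just (App s t) B)))"
| jT: "AxT \<in> S \<Longrightarrow> jscheme S (JImp (Just t A) A)"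
| jD: "AxD \<in> S \<Longrightarrow> jscheme S (JImp (Just t JBot) JBot)"
| j4: "Ax4 \<in> S \<Longrightarrow> jscheme S (JImp (Just t A) (Just (Bang t) (Just t A)))"
| jB: "AxB \<in> S \<Longrightarrow> jscheme S (JImp (JNeg A) (Just (BarQ t) (JNeg (Just t A))))"
| j5: "Ax5 \<in> S \<Longrightarrow> jscheme S (JImp (JNeg (Just t A)) (Just (Quest t) (JNeg (Just t A))))"

definition jaxiom :: "scheme set \<Rightarrow> jfml \<Rightarrow> bool" where
  "jaxiom S A \<longleftrightarrow> jscheme S A \<and> jfml_of S A"

text \<open>Since axioms are formulas of the language, so are all theorems. In rule \<open>ian\<close> the list
  \<open>cs\<close> is \<open>[c\<^sub>n, \<dots>, c\<^sub>1]\<close> with \<open>n \<ge> 1\<close>.\<close>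

inductive_set JustL :: "scheme set \<Rightarrow> jfml set" for S where
  axiom: "jaxiom S A \<Longrightarrow> A \<in> JustL S"
| mp: "JImp A B \<in> JustL S \<Longrightarrow> A \<in> JustL S \<Longrightarrow> B \<in> JustL S"
| an: "Ax4 \<in> S \<Longrightarrow> jaxiom S A \<Longrightarrow> Just (TConst c) A \<in> JustL S"
| ian: "Ax4 \<notin> S \<Longrightarrow> jaxiom S A \<Longrightarrow> cs \<noteq> [] \<Longrightarrow>
    foldr (\<lambda>c. Just (TConst c)) cs A \<in> JustL S"

abbreviation LP :: "jfml set" where "LP \<equiv> JustL {AxT, Ax4}"


section \<open>Forgetful projection and realization\<close>

primrec forget :: "jfml \<Rightarrow> mfml" where
  "forget (JVar p) = MVar p"
| "forget JBot = MBot"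
| "forget (JNeg A) = MNeg (forget A)"
| "forget (JAnd A B) = MAnd (forget A) (forget B)"
| "forget (JOr A B) = MOr (forget A) (forget B)"
| "forget (JImp A B) = MImp (forget A) (forget B)"
| "forget (Just t A) = Box (forget A)"

inductive realization :: "scheme set \<Rightarrow> mfml \<Rightarrow> jfml \<Rightarrow> bool" for S where
  "realization S (MVar p) (JVar p)"
| "realization S MBot JBot"
| "realization S A A' \<Longrightarrow> realization S (MNeg A) (JNeg A')"
| "realization S A A' \<Longrightarrow> realization S B B' \<Longrightarrow> realization S (MAnd A B) (JAnd A' B')"
| "realization S A A' \<Longrightarrow> realization S B B' \<Longrightarrow> realization S (MOr A B) (JOr A' B')"
| "realization S A A' \<Longrightarrow> realization S B B' \<Longrightarrow> realization S (MImp A B) (JImp A' B')"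
| "trm_of S t \<Longrightarrow> realization S A A' \<Longrightarrow> realization S (Box A) (Just t A')"

text \<open>\<open>occ_terms True G\<close> and \<open>occ_terms False G\<close> list the terms \<open>t\<close> of the positive and of the negative
  occurrences of subformulas \<open>t:A\<close> in \<open>G\<close>, one entry per occurrence. If \<open>G\<close> realizes \<open>F\<close>, these are
  the terms that replace the positive and the negative occurrences of \<open>\<box>\<close> in \<open>F\<close>.\<close>

primrec occ_terms :: "bool \<Rightarrow> jfml \<Rightarrow> trm list" where
  "occ_terms b (JVar p) = []"
| "occ_terms b JBot = []"
| "occ_terms b (JNeg A) = occ_terms (\<not> b) A"
| "occ_terms b (JAnd A B) = occ_terms b A @ occ_terms b B"
| "occ_terms b (JOr A B) = occ_terms b A @ occ_terms b B"
| "occ_terms b (JImp A B) = occ_terms (\<not> b) A @ occ_terms b B"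
| "occ_terms b (Just t A) = (if b then [t] else []) @ occ_terms b A"

definition normal :: "jfml \<Rightarrow> bool" where
  "normal G \<longleftrightarrow> distinct (occ_terms False G) \<and> set (occ_terms False G) \<subseteq> range TVar"

definition normal_realization :: "scheme set \<Rightarrow> mfml \<Rightarrow> jfml \<Rightarrow> bool" where
  "normal_realization S F G \<longleftrightarrow> realization S F G \<and> normal G"

end

theory Submission
  imports Defs
begin

text \<open>Forgetting terms turns axioms into modal theorems, so one inclusion of each equality is a short
  derivation in the modal logic. The other inclusion is contained in the existence of normal
  realizations, which has a semantic proof in the style of Fitting, the same for all 24 logics.

  The maximal consistent sets of a justification logic \<open>L\<close>, with \<open>\<Delta>\<close> accessible from \<open>\<Gamma>\<close> if \<open>t:A \<in> \<Gamma>\<close>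
  always gives \<open>A \<in> \<Delta>\<close>, form a Kripke frame on which each scheme of \<open>L\<close> enforces the frame
  condition of its modal counterpart (\<open>canonical_frame\<close>). The modal logic \<open>M\<close> is sound for this frame.
  Truth in the canonical model is controlled by
  quasi-realizations, in which formulas below a positive box may be finite disjunctions: if all
  positive quasi-realizations of \<open>F\<close> fail at a world, then so does \<open>F\<close> (\<open>truth_lemma\<close>). Hence for
  a theorem \<open>F\<close> of \<open>M\<close>, no maximal consistent set omits all quasi-realizations of \<open>F\<close>, and a finite
  disjunction of them is provable (\<open>provable_quasi_disjunction\<close>).

  Such a disjunction is finally merged into one formula. By induction on \<open>F\<close>, finitely many
  quasi-realizations have, after a substitution of terms for variables, a common normal
  realization that they all imply (\<open>condensing\<close>). The tool is internalization: every
  theorem is justified by a ground term, which no substitution can disturb.\<close>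


section \<open>Consequence in modal and justification logics\<close>

lemma ModL_conseq:
  assumes "set As \<subseteq> ModL S" and "\<And>v. \<forall>A \<in> set As. meval v A \<Longrightarrow> meval v B"
  shows "B \<in> ModL S"
  using assms
proof (induction As arbitrary: B)
  case Nil
  then have "mtaut B" by (simp add: mtaut_def)
  then show ?case by (intro ModL.axiom maxiom.taut)
next
  case (Cons A As)
  have "MImp A B \<in> ModL S" using Cons.prems by (intro Cons.IH) auto
  then show ?case using Cons.prems(1) by (auto intro: ModL.mp)
qed

lemma JustL_jfml_of: "A \<in> JustL S \<Longrightarrow> jfml_of S A"
proof (induction rule: JustL.induct)
  case (ian A cs)
  have "jfml_of S A" using ian(2) by (simp add: jaxiom_def)
  then show ?case by (induction cs) auto
qed (auto simp: jaxiom_def)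

text \<open>Theories in this sense serve three purposes: the logic itself, the sets of formulas justified in
  a maximal consistent set, and the maximal consistent sets all are instances.\<close>

definition jtheory :: "scheme set \<Rightarrow> jfml set \<Rightarrow> bool" where
  "jtheory S \<Gamma> \<longleftrightarrow> JustL S \<subseteq> \<Gamma> \<and> (\<forall>A \<in> \<Gamma>. jfml_of S A) \<and>
     (\<forall>A B. JImp A B \<in> \<Gamma> \<longrightarrow> A \<in> \<Gamma> \<longrightarrow> B \<in> \<Gamma>)"

lemma jtheoryD:
  assumes "jtheory S \<Gamma>"
  shows "A \<in> JustL S \<Longrightarrow> A \<in> \<Gamma>"
    and "A \<in> \<Gamma> \<Longrightarrow> jfml_of S A"
    and "JImp A B \<in> \<Gamma> \<Longrightarrow> A \<in> \<Gamma> \<Longrightarrow> B \<in> \<Gamma>"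
  using assms by (auto simp: jtheory_def)

lemma jtheory_JustL: "jtheory S (JustL S)"
  by (auto simp: jtheory_def JustL_jfml_of intro: JustL.mp)

lemma jtheory_conseq:
  assumes "jtheory S \<Gamma>" and "jfml_of S B" and "set As \<subseteq> \<Gamma>"
    and "\<And>v. \<forall>A \<in> set As. jeval v A \<Longrightarrow> jeval v B"
  shows "B \<in> \<Gamma>"
  using assms(2-)
proof (induction As arbitrary: B)
  case Nil
  then show ?case
    by (intro jtheoryD(1)[OF assms(1)] JustL.axiom)
      (auto simp: jaxiom_def jtaut_def intro: jscheme.taut)
next
  case (Cons A As)
  have "JImp A B \<in> \<Gamma>"
    using Cons.prems jtheoryD(2)[OF assms(1)] by (intro Cons.IH) auto
  then show ?case using Cons.prems(2) jtheoryD(3)[OF assms(1)] by auto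
qed

lemmas JustL_conseq = jtheory_conseq[OF jtheory_JustL]

lemma JustL_app:
  "Just s (JImp A B) \<in> JustL S \<Longrightarrow> trm_of S t \<Longrightarrow> jfml_of S A \<Longrightarrow>
    JImp (Just t A) (Just (App s t) B) \<in> JustL S"
  by (rule JustL.mp[OF JustL.axiom])
    (auto simp: jaxiom_def dest: JustL_jfml_of intro: jscheme.app)

definition disj :: "jfml list \<Rightarrow> jfml" where
  "disj Us = foldr JOr Us JBot"

lemma jeval_disj [simp]: "jeval v (disj Us) \<longleftrightarrow> (\<exists>U \<in> set Us. jeval v U)"
  by (induction Us) (auto simp: disj_def)

lemma jfml_of_disj [simp]: "jfml_of S (disj Us) \<longleftrightarrow> (\<forall>U \<in> set Us. jfml_of S U)"
  by (induction Us) (auto simp: disj_def)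


section \<open>Substitution and internalization\<close>

primrec tsubst :: "(nat \<Rightarrow> trm) \<Rightarrow> trm \<Rightarrow> trm" where
  "tsubst \<sigma> (TVar x) = \<sigma> x"
| "tsubst \<sigma> (TConst c) = TConst c"
| "tsubst \<sigma> (App s t) = App (tsubst \<sigma> s) (tsubst \<sigma> t)"
| "tsubst \<sigma> (Sum s t) = Sum (tsubst \<sigma> s) (tsubst \<sigma> t)"
| "tsubst \<sigma> (Bang t) = Bang (tsubst \<sigma> t)"
| "tsubst \<sigma> (BarQ t) = BarQ (tsubst \<sigma> t)"
| "tsubst \<sigma> (Quest t) = Quest (tsubst \<sigma> t)"

primrec jsubst :: "(nat \<Rightarrow> trm) \<Rightarrow> jfml \<Rightarrow> jfml" where
  "jsubst \<sigma> (JVar p) = JVar p"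
| "jsubst \<sigma> JBot = JBot"
| "jsubst \<sigma> (JNeg A) = JNeg (jsubst \<sigma> A)"
| "jsubst \<sigma> (JAnd A B) = JAnd (jsubst \<sigma> A) (jsubst \<sigma> B)"
| "jsubst \<sigma> (JOr A B) = JOr (jsubst \<sigma> A) (jsubst \<sigma> B)"
| "jsubst \<sigma> (JImp A B) = JImp (jsubst \<sigma> A) (jsubst \<sigma> B)"
| "jsubst \<sigma> (Just t A) = Just (tsubst \<sigma> t) (jsubst \<sigma> A)"

lemma tsubst_comp: "tsubst \<tau> (tsubst \<sigma> t) = tsubst (\<lambda>i. tsubst \<tau> (\<sigma> i)) t"
  by (induction t) auto

lemma jsubst_comp: "jsubst \<tau> (jsubst \<sigma> A) = jsubst (\<lambda>i. tsubst \<tau> (\<sigma> i)) A"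
  by (induction A) (auto simp: tsubst_comp)

lemma jsubst_disj: "jsubst \<sigma> (disj Us) = disj (map (jsubst \<sigma>) Us)"
  by (induction Us) (auto simp: disj_def)

lemma trm_of_tsubst: "(\<And>i. trm_of S (\<sigma> i)) \<Longrightarrow> trm_of S t \<Longrightarrow> trm_of S (tsubst \<sigma> t)"
  by (induction t) auto

lemma jfml_of_jsubst: "(\<And>i. trm_of S (\<sigma> i)) \<Longrightarrow> jfml_of S A \<Longrightarrow> jfml_of S (jsubst \<sigma> A)"
  by (induction A) (auto simp: trm_of_tsubst)

lemma jeval_jsubst: "jeval v (jsubst \<sigma> A) = jeval (\<lambda>X. v (jsubst \<sigma> X)) A"
  by (induction A) auto

lemma jscheme_jsubst: "jscheme S A \<Longrightarrow> jscheme S (jsubst \<sigma> A)"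
  by (induction rule: jscheme.induct)
    (auto simp: jtaut_def jeval_jsubst intro: jscheme.intros)

lemma jaxiom_jsubst: "(\<And>i. trm_of S (\<sigma> i)) \<Longrightarrow> jaxiom S A \<Longrightarrow> jaxiom S (jsubst \<sigma> A)"
  by (simp add: jaxiom_def jscheme_jsubst jfml_of_jsubst)

text \<open>Constants are left in place by a substitution, and every constant justifies every axiom; hence
  a substitution instance of an application of axiom necessitation is another one.\<close>

lemma JustL_jsubst:
  assumes \<sigma>: "\<And>i. trm_of S (\<sigma> i)" and "A \<in> JustL S"
  shows "jsubst \<sigma> A \<in> JustL S"
  using assms(2)
proof (induction rule: JustL.induct)
  case (ian A cs)
  have "jsubst \<sigma> (foldr (\<lambda>c. Just (TConst c)) cs A)
      = foldr (\<lambda>c. Just (TConst c)) cs (jsubst \<sigma> A)"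
    by (induction cs) auto
  then show ?case using ian jaxiom_jsubst[OF \<sigma>] by (auto intro: JustL.ian)
qed (auto intro: JustL.intros jaxiom_jsubst[OF \<sigma>])

text \<open>Each rule lifts to the level of terms: modus ponens to application, and axiom necessitation to
  one more constant or to \<open>!\<close>. No variable enters, so the term that arises is ground, which is
  expressed by its invariance under all substitutions.\<close>

lemma internalization:
  assumes "A \<in> JustL S"
  shows "\<exists>t. trm_of S t \<and> (\<forall>\<sigma>. tsubst \<sigma> t = t) \<and> Just t A \<in> JustL S"
  using assms
proof (induction rule: JustL.induct)
  case (axiom A)
  have "Just (TConst 0) A \<in> JustL S"
    using axiom JustL.an JustL.ian[of S A "[0]"] by (cases "Ax4 \<in> S") auto
  then show ?case by (intro exI[of _ "TConst 0"]) auto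
next
  case (mp A B)
  then obtain s t where
    st: "trm_of S s" "\<forall>\<sigma>. tsubst \<sigma> s = s" "Just s (JImp A B) \<in> JustL S"
      "trm_of S t" "\<forall>\<sigma>. tsubst \<sigma> t = t" "Just t A \<in> JustL S"
    by blast
  have "Just (App s t) B \<in> JustL S"
    using JustL_app[OF st(3,4)] st(6) mp(2) by (auto dest: JustL_jfml_of intro: JustL.mp)
  then show ?case using st by (intro exI[of _ "App s t"]) auto
next
  case (an A c)
  have "Just (Bang (TConst c)) (Just (TConst c) A) \<in> JustL S"
    using an by (intro JustL.mp[OF JustL.axiom JustL.an])
      (auto simp: jaxiom_def intro: jscheme.j4)
  then show ?case using an by (intro exI[of _ "Bang (TConst c)"]) auto
next
  case (ian A cs)
  have "Just (TConst 0) (foldr (\<lambda>c. Just (TConst c)) cs A) \<in> JustL S"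
    using JustL.ian[OF ian(1,2), of "0 # cs"] by simp
  then show ?case by (intro exI[of _ "TConst 0"]) auto
qed

lemma JustL_weaken_sum:
  assumes "Just s A \<in> JustL S" and "trm_of S t"
  shows "Just (Sum s t) A \<in> JustL S" and "Just (Sum t s) A \<in> JustL S"
proof -
  have "jaxiom S (JImp (Just s A) (Just (Sum s t) A))"
    "jaxiom S (JImp (Just s A) (Just (Sum t s) A))"
    using assms(2) JustL_jfml_of[OF assms(1)]
    by (simp_all add: jaxiom_def jscheme.sumL jscheme.sumR)
  then show "Just (Sum s t) A \<in> JustL S" and "Just (Sum t s) A \<in> JustL S"
    using assms(1) by (blast intro: JustL.axiom JustL.mp)+
qed

lemma uniform_internalization:
  assumes "finite X" and "X \<subseteq> JustL S"
  shows "\<exists>t. trm_of S t \<and> (\<forall>\<sigma>. tsubst \<sigma> t = t) \<and> (\<forall>A \<in> X. Just t A \<in> JustL S)"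
  using assms
proof (induction X rule: finite_induct)
  case empty
  show ?case by (intro exI[of _ "TConst 0"]) auto
next
  case (insert A X)
  then obtain s where s: "trm_of S s" "\<forall>\<sigma>. tsubst \<sigma> s = s" "\<forall>A \<in> X. Just s A \<in> JustL S" by auto
  obtain t where t: "trm_of S t" "\<forall>\<sigma>. tsubst \<sigma> t = t" "Just t A \<in> JustL S"
    using internalization insert.prems by blast
  show ?case using s t
    by (intro exI[of _ "Sum s t"]) (auto intro: JustL_weaken_sum)
qed

lemma common_upper_term:
  assumes "finite T" and "\<forall>t \<in> T. trm_of S t"
  shows "\<exists>u. trm_of S u \<and>
    (\<forall>t \<in> T. \<forall>A. jfml_of S A \<longrightarrow> JImp (Just t A) (Just u A) \<in> JustL S)"
  using assms
proof (induction T rule: finite_induct)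
  case empty
  show ?case by (intro exI[of _ "TConst 0"]) auto
next
  case (insert r T)
  then obtain u where u: "trm_of S u"
    "\<And>t A. t \<in> T \<Longrightarrow> jfml_of S A \<Longrightarrow> JImp (Just t A) (Just u A) \<in> JustL S" by auto
  have r: "trm_of S r" and T: "\<And>t. t \<in> T \<Longrightarrow> trm_of S t" using insert.prems by auto
  have "JImp (Just t A) (Just (Sum r u) A) \<in> JustL S" if "t \<in> insert r T" "jfml_of S A" for t A
  proof (cases "t = r")
    case True
    then show ?thesis using r u(1) that(2)
      by (intro JustL.axiom) (auto simp: jaxiom_def intro: jscheme.sumL)
  next
    case False
    then have "t \<in> T" using that by simp
    have "JImp (Just u A) (Just (Sum r u) A) \<in> JustL S"
      using r u(1) that(2) by (intro JustL.axiom) (auto simp: jaxiom_def intro: jscheme.sumR)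
    then show ?thesis
      using u(2)[OF \<open>t \<in> T\<close> that(2)] u(1) r T[OF \<open>t \<in> T\<close>] that(2)
      by (intro JustL_conseq[where As = "[JImp (Just t A) (Just u A), JImp (Just u A) (Just (Sum r u) A)]"])
         auto
  qed
  then show ?case using r u(1) by (intro exI[of _ "Sum r u"]) auto
qed


section \<open>Forgetful projections are modal theorems\<close>

lemma meval_forget: "meval v (forget A) = jeval (\<lambda>X. v (forget X)) A"
  by (induction A) auto

text \<open>The first five conditions ensure that \<open>M\<close> proves every scheme of \<open>L\<close>: (D) follows from (T), (4)
  from (B) and (5), and (B) from (T) and (5). The other five ensure that frames for \<open>L\<close> are frames
  for \<open>M\<close>; for example, a serial, symmetric and transitive relation is reflexive.\<close>

definition matches :: "scheme set \<Rightarrow> scheme set \<Rightarrow> bool" where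
  "matches L M \<longleftrightarrow>
    (AxT \<in> L \<longrightarrow> AxT \<in> M) \<and>
    (AxD \<in> L \<longrightarrow> AxD \<in> M \<or> AxT \<in> M) \<and>
    (Ax4 \<in> L \<longrightarrow> Ax4 \<in> M \<or> AxB \<in> M \<and> Ax5 \<in> M) \<and>
    (AxB \<in> L \<longrightarrow> AxB \<in> M \<or> AxT \<in> M \<and> Ax5 \<in> M) \<and>
    (Ax5 \<in> L \<longrightarrow> Ax5 \<in> M) \<and>
    (AxT \<in> M \<longrightarrow> AxT \<in> L \<or> AxD \<in> L \<and> AxB \<in> L \<and> (Ax4 \<in> L \<or> Ax5 \<in> L)) \<and>
    (AxD \<in> M \<longrightarrow> AxD \<in> L) \<and>
    (Ax4 \<in> M \<longrightarrow> Ax4 \<in> L \<or> Ax5 \<in> L \<and> (AxT \<in> L \<or> AxB \<in> L)) \<and>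
    (AxB \<in> M \<longrightarrow> AxB \<in> L) \<and>
    (Ax5 \<in> M \<longrightarrow> Ax5 \<in> L \<or> AxB \<in> L \<and> Ax4 \<in> L)"

text \<open>From \<open>\<box>A\<close>, the scheme (B) gives \<open>\<box>\<not>\<box>\<not>\<box>A\<close>, and under the outer box the contraposed (5) turns
  \<open>\<not>\<box>\<not>\<box>A\<close> into \<open>\<box>A\<close>.\<close>

lemma KB5_proves_4:
  assumes "AxB \<in> S" and "Ax5 \<in> S"
  shows "MImp (Box A) (Box (Box A)) \<in> ModL S"
proof -
  let ?N = "MNeg (Box (MNeg (Box A)))"
  have "MImp (MNeg (Box A)) (Box (MNeg (Box A))) \<in> ModL S"
    using assms by (intro ModL.axiom maxiom.Five)
  then have "MImp ?N (Box A) \<in> ModL S"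
    by (intro ModL_conseq[where As = "[MImp (MNeg (Box A)) (Box (MNeg (Box A)))]"]) auto
  then have "MImp (Box ?N) (Box (Box A)) \<in> ModL S"
    by (rule ModL.mp[OF ModL.axiom[OF maxiom.K] ModL.nec])
  moreover have "MImp (MNeg (MNeg (Box A))) (Box ?N) \<in> ModL S"
    using assms by (intro ModL.axiom maxiom.B)
  ultimately show ?thesis
    by (intro ModL_conseq[where As =
      "[MImp (Box ?N) (Box (Box A)), MImp (MNeg (MNeg (Box A))) (Box ?N)]"]) auto
qed

lemma T5_proves_B:
  assumes "AxT \<in> S" and "Ax5 \<in> S"
  shows "MImp (MNeg A) (Box (MNeg (Box A))) \<in> ModL S"
proof -
  have "MImp (Box A) A \<in> ModL S" "MImp (MNeg (Box A)) (Box (MNeg (Box A))) \<in> ModL S"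
    using assms by (auto intro: ModL.axiom maxiom.T maxiom.Five)
  then show ?thesis
    by (intro ModL_conseq[where As =
      "[MImp (Box A) A, MImp (MNeg (Box A)) (Box (MNeg (Box A)))]"]) auto
qed

lemma forget_jscheme:
  assumes "jscheme L A" and "matches L M"
  shows "forget A \<in> ModL M"
  using assms(1)
proof cases
  case taut
  then have "mtaut (forget A)" by (simp add: mtaut_def jtaut_def meval_forget)
  then show ?thesis by (intro ModL.axiom maxiom.taut)
next
  case (jD t)
  then have "AxD \<in> M \<or> AxT \<in> M" using assms(2) by (simp add: matches_def)
  then show ?thesis using jD by (auto intro: ModL.axiom maxiom.D maxiom.T)
next
  case (j4 t B)
  then have "Ax4 \<in> M \<or> AxB \<in> M \<and> Ax5 \<in> M" using assms(2) by (simp add: matches_def)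
  then show ?thesis using j4 KB5_proves_4 by (auto intro: ModL.axiom maxiom.Four)
next
  case (jB B t)
  then have "AxB \<in> M \<or> AxT \<in> M \<and> Ax5 \<in> M" using assms(2) by (simp add: matches_def)
  then show ?thesis using jB T5_proves_B by (auto intro: ModL.axiom maxiom.B)
next
  case (app s B C t)
  then show ?thesis by (simp add: ModL.axiom maxiom.K)
next
  case (jT t B)
  then have "AxT \<in> M" using assms(2) by (simp add: matches_def)
  then show ?thesis using jT by (simp add: ModL.axiom maxiom.T)
next
  case (j5 t B)
  then have "Ax5 \<in> M" using assms(2) by (simp add: matches_def)
  then show ?thesis using j5 by (simp add: ModL.axiom maxiom.Five)
qed (simp_all add: mtaut_def ModL.axiom maxiom.taut)

lemma forget_JustL:
  assumes "matches L M" and "A \<in> JustL L"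
  shows "forget A \<in> ModL M"
  using assms(2)
proof (induction rule: JustL.induct)
  case (mp A B)
  then show ?case by (auto intro: ModL.mp)
next
  case (ian A cs)
  show ?case
    by (induction cs)
      (use forget_jscheme[of L A M] ian(2) assms(1) in \<open>auto simp: jaxiom_def intro: ModL.nec\<close>)
qed (use assms(1) in \<open>auto simp: jaxiom_def intro: forget_jscheme ModL.nec\<close>)


section \<open>Kripke soundness of the modal logics\<close>

primrec forces :: "('w \<Rightarrow> 'w \<Rightarrow> bool) \<Rightarrow> ('w \<Rightarrow> nat \<Rightarrow> bool) \<Rightarrow> 'w \<Rightarrow> mfml \<Rightarrow> bool" where
  "forces R V w (MVar p) = V w p"
| "forces R V w MBot = False"
| "forces R V w (MNeg A) = (\<not> forces R V w A)"
| "forces R V w (MAnd A B) = (forces R V w A \<and> forces R V w B)"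
| "forces R V w (MOr A B) = (forces R V w A \<or> forces R V w B)"
| "forces R V w (MImp A B) = (forces R V w A \<longrightarrow> forces R V w B)"
| "forces R V w (Box A) = (\<forall>u. R w u \<longrightarrow> forces R V u A)"

locale frame =
  fixes S :: "scheme set" and W :: "'w set" and R :: "'w \<Rightarrow> 'w \<Rightarrow> bool"
  assumes worlds: "R w u \<Longrightarrow> w \<in> W \<and> u \<in> W"
    and refl: "AxT \<in> S \<Longrightarrow> w \<in> W \<Longrightarrow> R w w"
    and serial: "AxD \<in> S \<Longrightarrow> w \<in> W \<Longrightarrow> \<exists>u. R w u"
    and trans: "Ax4 \<in> S \<Longrightarrow> R w u \<Longrightarrow> R u v \<Longrightarrow> R w v"
    and symm: "AxB \<in> S \<Longrightarrow> R w u \<Longrightarrow> R u w"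
    and eucl: "Ax5 \<in> S \<Longrightarrow> R w u \<Longrightarrow> R w v \<Longrightarrow> R u v"

lemma forces_meval: "forces R V w A = meval (forces R V w) A"
  by (induction A) auto

lemma (in frame) soundness:
  assumes "A \<in> ModL S" and "w \<in> W"
  shows "forces R V w A"
  using assms
proof (induction arbitrary: w rule: ModL.induct)
  case (axiom A)
  show ?case using axiom(1)
  proof cases
    case taut
    then show ?thesis unfolding forces_meval[of R V w A] by (simp add: mtaut_def)
  next
    case (T A)
    then show ?thesis using refl[OF T(2) axiom(2)] by simp
  next
    case D
    then show ?thesis using serial[OF D(2) axiom(2)] by simp
  next
    case (Four A)
    then show ?thesis using trans[OF Four(2), of w] by auto
  next
    case (B A)
    then show ?thesis using symm[OF B(2), of w] by auto
  next
    case (Five A)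
    then show ?thesis using eucl[OF Five(2), of w] by auto
  qed simp
next
  case (nec A)
  then show ?case using worlds[of w] by simp
qed auto

lemma (in frame) matches_frame:
  assumes "matches S M"
  shows "frame M W R"
proof
  show "R w u \<Longrightarrow> w \<in> W \<and> u \<in> W" for w u by (rule worlds)
  show "R w w" if M: "AxT \<in> M" and w: "w \<in> W" for w
  proof (cases "AxT \<in> S")
    case False
    then have S: "AxD \<in> S" "AxB \<in> S" "Ax4 \<in> S \<or> Ax5 \<in> S"
      using M assms by (auto simp: matches_def)
    then obtain u where "R w u" "R u w" using serial[OF _ w] symm by blast
    then show ?thesis using S(3) trans[of w u w] eucl[of u w w] by blast
  qed (rule refl[OF _ w])
  show "\<exists>u. R w u" if "AxD \<in> M" "w \<in> W" for w
    using that assms serial[of w] by (simp add: matches_def)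
  show "R w v" if M: "Ax4 \<in> M" and wu: "R w u" and uv: "R u v" for w u v
  proof (cases "Ax4 \<in> S")
    case False
    then have S: "Ax5 \<in> S" "AxT \<in> S \<or> AxB \<in> S" using M assms by (auto simp: matches_def)
    then have "R u w" using eucl[OF _ wu refl] symm[OF _ wu] worlds[OF wu] by blast
    then show ?thesis using eucl[OF S(1) _ uv] by blast
  qed (rule trans[OF _ wu uv])
  show "R u w" if "AxB \<in> M" "R w u" for w u
    using that assms symm[of w u] by (simp add: matches_def)
  show "R u v" if "Ax5 \<in> M" "R w u" "R w v" for w u v
    using that assms symm[of w u] trans[of u w v] eucl[of w u v] by (auto simp: matches_def)
qed


section \<open>The canonical model of a justification logic\<close>

definition mcs :: "scheme set \<Rightarrow> jfml set \<Rightarrow> bool" where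
  "mcs S \<Gamma> \<longleftrightarrow> jtheory S \<Gamma> \<and> JBot \<notin> \<Gamma> \<and> (\<forall>A. jfml_of S A \<longrightarrow> A \<in> \<Gamma> \<or> JNeg A \<in> \<Gamma>)"

text \<open>A Lindenbaum lemma. By Zorn there is a maximal theory that contains \<open>D\<close> and no finite
  disjunction over \<open>Q\<close>, not even the empty one, which is \<open>\<bottom>\<close>. Were it undecided on \<open>A\<close>, then both extensions, by \<open>A\<close> and by its negation,
  would contain such a disjunction, and so would the theory itself.\<close>

lemma separating_mcs:
  assumes "jtheory S D" and Q: "\<forall>U \<in> Q. jfml_of S U" and "\<forall>Us \<in> lists Q. disj Us \<notin> D"
  shows "\<exists>\<Delta>. mcs S \<Delta> \<and> D \<subseteq> \<Delta> \<and> \<Delta> \<inter> Q = {}"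
proof -
  define \<C> where "\<C> = {\<Gamma>. jtheory S \<Gamma> \<and> D \<subseteq> \<Gamma> \<and> (\<forall>Us \<in> lists Q. disj Us \<notin> \<Gamma>)}"
  have "\<exists>\<Delta> \<in> \<C>. \<forall>X \<in> \<C>. \<Delta> \<subseteq> X \<longrightarrow> X = \<Delta>"
  proof (rule subset_Zorn_nonempty)
    show "\<C> \<noteq> {}" using assms by (auto simp: \<C>_def)
  next
    fix C assume "C \<noteq> {}" and "subset.chain \<C> C"
    then have "C \<subseteq> \<C>" and chain: "\<And>X Y. X \<in> C \<Longrightarrow> Y \<in> C \<Longrightarrow> X \<subseteq> Y \<or> Y \<subseteq> X"
      by (auto simp: subset_chain_def)
    then have th: "\<And>\<Gamma>. \<Gamma> \<in> C \<Longrightarrow> jtheory S \<Gamma>" and D: "\<And>\<Gamma>. \<Gamma> \<in> C \<Longrightarrow> D \<subseteq> \<Gamma>"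
      and nodisj: "\<And>\<Gamma> Us. \<Gamma> \<in> C \<Longrightarrow> Us \<in> lists Q \<Longrightarrow> disj Us \<notin> \<Gamma>"
      unfolding \<C>_def by blast+
    have "jtheory S (\<Union>C)" unfolding jtheory_def
    proof (intro conjI ballI allI impI)
      show "JustL S \<subseteq> \<Union>C" using \<open>C \<noteq> {}\<close> jtheoryD(1)[OF th] by blast
      show "jfml_of S A" if "A \<in> \<Union>C" for A using that jtheoryD(2)[OF th] by blast
      show "B \<in> \<Union>C" if imp: "JImp A B \<in> \<Union>C" and A: "A \<in> \<Union>C" for A B
      proof -
        obtain X Y where XY: "X \<in> C" "JImp A B \<in> X" "Y \<in> C" "A \<in> Y" using imp A by auto
        then obtain Z where Z: "Z \<in> C" "JImp A B \<in> Z" "A \<in> Z" using chain[of X Y] by auto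
        then show ?thesis using jtheoryD(3)[OF th] by blast
      qed
    qed
    moreover have "D \<subseteq> \<Union>C" using \<open>C \<noteq> {}\<close> D by blast
    ultimately show "\<Union>C \<in> \<C>" using nodisj by (auto simp: \<C>_def)
  qed
  then obtain \<Delta> where \<Delta>: "\<Delta> \<in> \<C>" "\<And>X. X \<in> \<C> \<Longrightarrow> \<Delta> \<subseteq> X \<Longrightarrow> X = \<Delta>" by blast
  have th: "jtheory S \<Delta>" and "D \<subseteq> \<Delta>" and nodisj: "\<And>Us. Us \<in> lists Q \<Longrightarrow> disj Us \<notin> \<Delta>"
    using \<Delta>(1) by (auto simp: \<C>_def)
  have ext: "\<exists>Us \<in> lists Q. JImp A (disj Us) \<in> \<Delta>" if A: "jfml_of S A" "A \<notin> \<Delta>" for A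
  proof (rule ccontr)
    assume no: "\<not> ?thesis"
    let ?X = "{X. JImp A X \<in> \<Delta>}"
    have sub: "\<Delta> \<subseteq> ?X"
    proof
      fix X assume "X \<in> \<Delta>"
      then have "JImp A X \<in> \<Delta>"
        using A(1) jtheoryD(2)[OF th] by (intro jtheory_conseq[OF th, where As = "[X]"]) auto
      then show "X \<in> ?X" by simp
    qed
    have "jtheory S ?X" unfolding jtheory_def
    proof (intro conjI allI impI ballI)
      show "JustL S \<subseteq> ?X" using sub jtheoryD(1)[OF th] by auto
      show "jfml_of S X" if "X \<in> ?X" for X using that jtheoryD(2)[OF th, of "JImp A X"] by simp
      show "Y \<in> ?X" if XY: "JImp X Y \<in> ?X" "X \<in> ?X" for X Y
      proof -
        have "JImp A Y \<in> \<Delta>"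
          using XY jtheoryD(2)[OF th, of "JImp A (JImp X Y)"]
          by (intro jtheory_conseq[OF th, where As = "[JImp A (JImp X Y), JImp A X]"]) auto
        then show ?thesis by simp
      qed
    qed
    then have "?X \<in> \<C>" using no sub \<open>D \<subseteq> \<Delta>\<close> by (auto simp: \<C>_def)
    then have "?X = \<Delta>" using \<Delta>(2) sub by blast
    moreover have "JImp A A \<in> \<Delta>"
      using A(1) by (intro jtheory_conseq[OF th, where As = "[]"]) auto
    ultimately show False using A(2) by blast
  qed
  have "A \<in> \<Delta> \<or> JNeg A \<in> \<Delta>" if "jfml_of S A" for A
  proof (rule ccontr)
    assume "\<not> ?thesis"
    then obtain Us Vs where UV: "Us \<in> lists Q" "JImp A (disj Us) \<in> \<Delta>"
      "Vs \<in> lists Q" "JImp (JNeg A) (disj Vs) \<in> \<Delta>"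
      using ext[of A] ext[of "JNeg A"] \<open>jfml_of S A\<close> by (simp del: in_lists_conv_set) blast
    have "jfml_of S (disj (Us @ Vs))" using UV(1,3) Q by auto
    then have "disj (Us @ Vs) \<in> \<Delta>"
      by (rule jtheory_conseq[OF th, where As = "[JImp A (disj Us), JImp (JNeg A) (disj Vs)]"])
        (use UV(2,4) in auto)
    then show False using nodisj UV(1,3) by simp
  qed
  moreover have "JBot \<notin> \<Delta>" using nodisj[of "[]"] by (simp add: disj_def)
  moreover have "U \<notin> \<Delta>" if "U \<in> Q" for U
  proof
    assume "U \<in> \<Delta>"
    then have "disj [U] \<in> \<Delta>"
      using Q \<open>U \<in> Q\<close> by (intro jtheory_conseq[OF th, where As = "[U]"]) auto
    then show False using nodisj \<open>U \<in> Q\<close> by simp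
  qed
  ultimately show ?thesis using th \<open>D \<subseteq> \<Delta>\<close> unfolding mcs_def by blast
qed

lemma mcs_connectives:
  assumes "mcs S \<Gamma>"
  shows "jfml_of S A \<Longrightarrow> JNeg A \<in> \<Gamma> \<longleftrightarrow> A \<notin> \<Gamma>"
    and "jfml_of S A \<Longrightarrow> jfml_of S B \<Longrightarrow> JAnd A B \<in> \<Gamma> \<longleftrightarrow> A \<in> \<Gamma> \<and> B \<in> \<Gamma>"
    and "jfml_of S A \<Longrightarrow> jfml_of S B \<Longrightarrow> JOr A B \<in> \<Gamma> \<longleftrightarrow> A \<in> \<Gamma> \<or> B \<in> \<Gamma>"
    and "jfml_of S A \<Longrightarrow> jfml_of S B \<Longrightarrow> JImp A B \<in> \<Gamma> \<longleftrightarrow> (A \<in> \<Gamma> \<longrightarrow> B \<in> \<Gamma>)"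
proof -
  have th: "jtheory S \<Gamma>" and bot: "JBot \<notin> \<Gamma>"
    and dec: "\<And>A. jfml_of S A \<Longrightarrow> A \<in> \<Gamma> \<or> JNeg A \<in> \<Gamma>"
    using assms by (auto simp: mcs_def)
  note infer = jtheory_conseq[OF th]
  have neg: "JNeg A \<in> \<Gamma> \<longleftrightarrow> A \<notin> \<Gamma>" if "jfml_of S A" for A
  proof -
    have "A \<in> \<Gamma> \<Longrightarrow> JNeg A \<in> \<Gamma> \<Longrightarrow> JBot \<in> \<Gamma>"
      by (rule infer[where As = "[A, JNeg A]"]) auto
    then show ?thesis using bot dec[OF that] by blast
  qed
  show "jfml_of S A \<Longrightarrow> JNeg A \<in> \<Gamma> \<longleftrightarrow> A \<notin> \<Gamma>" by (rule neg)
  assume A: "jfml_of S A" and B: "jfml_of S B"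
  have "JAnd A B \<in> \<Gamma> \<Longrightarrow> A \<in> \<Gamma>" "JAnd A B \<in> \<Gamma> \<Longrightarrow> B \<in> \<Gamma>"
    using A B by (auto intro: infer[where As = "[JAnd A B]"])
  moreover have "JAnd A B \<in> \<Gamma>" if "A \<in> \<Gamma>" "B \<in> \<Gamma>"
    using A B that by (intro infer[where As = "[A, B]"]) auto
  ultimately show "JAnd A B \<in> \<Gamma> \<longleftrightarrow> A \<in> \<Gamma> \<and> B \<in> \<Gamma>" by blast
  have "JOr A B \<in> \<Gamma>" if "A \<in> \<Gamma>"
    using A B that by (intro infer[where As = "[A]"]) auto
  moreover have "JOr A B \<in> \<Gamma>" if "B \<in> \<Gamma>"
    using A B that by (intro infer[where As = "[B]"]) auto
  moreover have "B \<in> \<Gamma>" if "JOr A B \<in> \<Gamma>" "JNeg A \<in> \<Gamma>"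
    using A B that by (intro infer[where As = "[JOr A B, JNeg A]" and B = B]) auto
  ultimately show "JOr A B \<in> \<Gamma> \<longleftrightarrow> A \<in> \<Gamma> \<or> B \<in> \<Gamma>" using neg[OF A] by blast
  have "JImp A B \<in> \<Gamma>" if "JNeg A \<in> \<Gamma>"
    using A B that by (intro infer[where As = "[JNeg A]"]) auto
  moreover have "JImp A B \<in> \<Gamma>" if "B \<in> \<Gamma>"
    using A B that by (intro infer[where As = "[B]"]) auto
  ultimately show "JImp A B \<in> \<Gamma> \<longleftrightarrow> (A \<in> \<Gamma> \<longrightarrow> B \<in> \<Gamma>)"
    using neg[OF A] jtheoryD(3)[OF th] by blast
qed

definition canR :: "scheme set \<Rightarrow> jfml set \<Rightarrow> jfml set \<Rightarrow> bool" where
  "canR S \<Gamma> \<Delta> \<longleftrightarrow> mcs S \<Gamma> \<and> mcs S \<Delta> \<and> (\<forall>t A. Just t A \<in> \<Gamma> \<longrightarrow> A \<in> \<Delta>)"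

lemma jtheory_justified:
  assumes "mcs S \<Gamma>"
  shows "jtheory S {A. \<exists>t. Just t A \<in> \<Gamma>}"
proof -
  have th: "jtheory S \<Gamma>" using assms by (simp add: mcs_def)
  have "\<exists>r. Just r B \<in> \<Gamma>" if s: "Just s (JImp A B) \<in> \<Gamma>" and t: "Just t A \<in> \<Gamma>" for s t A B
  proof -
    have "JImp (Just s (JImp A B)) (JImp (Just t A) (Just (App s t) B)) \<in> JustL S"
      using jtheoryD(2)[OF th s] jtheoryD(2)[OF th t]
      by (intro JustL.axiom) (auto simp: jaxiom_def intro: jscheme.app)
    then have "Just (App s t) B \<in> \<Gamma>" using s t jtheoryD(1,3)[OF th] by blast
    then show ?thesis ..
  qed
  moreover have "\<exists>t. Just t A \<in> \<Gamma>" if "A \<in> JustL S" for A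
    using internalization[OF that] jtheoryD(1)[OF th] by blast
  moreover have "jfml_of S A" if "Just t A \<in> \<Gamma>" for t A
    using jtheoryD(2)[OF th that] by simp
  ultimately show ?thesis unfolding jtheory_def by blast
qed

lemma canR_witness:
  assumes "mcs S \<Gamma>" and "\<forall>U \<in> Q. jfml_of S U" and "\<forall>t. \<forall>Us \<in> lists Q. Just t (disj Us) \<notin> \<Gamma>"
  shows "\<exists>\<Delta>. canR S \<Gamma> \<Delta> \<and> \<Delta> \<inter> Q = {}"
proof -
  obtain \<Delta> where "mcs S \<Delta>" "{A. \<exists>t. Just t A \<in> \<Gamma>} \<subseteq> \<Delta>" "\<Delta> \<inter> Q = {}"
    using separating_mcs[OF jtheory_justified[OF assms(1)] assms(2)] assms(3) by auto
  then have "canR S \<Gamma> \<Delta>" using assms(1) by (auto simp: canR_def)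
  then show ?thesis using \<open>\<Delta> \<inter> Q = {}\<close> by blast
qed

text \<open>Each justification scheme turns into the frame condition of its modal counterpart, as in the
  usual canonicity arguments; for (jD), an inconsistent set of justified formulas would put a
  formula \<open>t:\<bottom>\<close> into \<open>\<Gamma>\<close>.\<close>

lemma canonical_frame: "frame S {\<Gamma>. mcs S \<Gamma>} (canR S)"
proof -
  have ax: "B \<in> \<Gamma>" if "mcs S \<Gamma>" "jscheme S (JImp A B)" "A \<in> \<Gamma>" "jfml_of S B" for A B \<Gamma>
  proof -
    have th: "jtheory S \<Gamma>" using that by (simp add: mcs_def)
    have "JImp A B \<in> JustL S"
      using that jtheoryD(2)[OF th] by (intro JustL.axiom) (auto simp: jaxiom_def)
    then show ?thesis using that jtheoryD(1,3)[OF th] by blast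
  qed
  have lang: "jfml_of S A \<and> trm_of S t" if "mcs S \<Gamma>" "Just t A \<in> \<Gamma>" for \<Gamma> t A
    using that jtheoryD(2)[of S \<Gamma> "Just t A"] by (simp add: mcs_def)
  have bot: "JBot \<notin> \<Gamma>" if "mcs S \<Gamma>" for \<Gamma> using that by (simp add: mcs_def)
  note neg = mcs_connectives(1)
  have T: "canR S \<Gamma> \<Gamma>" if "AxT \<in> S" "mcs S \<Gamma>" for \<Gamma>
    using that ax[OF that(2) jscheme.jT[OF that(1)]] lang by (auto simp: canR_def)
  have D: "\<exists>\<Delta>. canR S \<Gamma> \<Delta>" if "AxD \<in> S" "mcs S \<Gamma>" for \<Gamma>
  proof -
    have "Just t JBot \<notin> \<Gamma>" for t
      using ax[OF that(2) jscheme.jD[OF that(1)]] bot[OF that(2)] by auto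
    then show ?thesis using canR_witness[of S \<Gamma> "{}"] that by (auto simp: disj_def)
  qed
  have Four: "canR S \<Gamma> \<Theta>" if "Ax4 \<in> S" "canR S \<Gamma> \<Delta>" "canR S \<Delta> \<Theta>" for \<Gamma> \<Delta> \<Theta>
  proof -
    have "A \<in> \<Theta>" if t: "Just t A \<in> \<Gamma>" for t A
    proof -
      have "mcs S \<Gamma>" using \<open>canR S \<Gamma> \<Delta>\<close> by (simp add: canR_def)
      then have "Just (Bang t) (Just t A) \<in> \<Gamma>"
        using ax[OF _ jscheme.j4 t] lang[OF _ t] \<open>Ax4 \<in> S\<close> by auto
      then show ?thesis using that \<open>canR S \<Gamma> \<Delta>\<close> \<open>canR S \<Delta> \<Theta>\<close> unfolding canR_def by blast
    qed
    then show ?thesis using that by (auto simp: canR_def)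
  qed
  have B: "canR S \<Delta> \<Gamma>" if "AxB \<in> S" "canR S \<Gamma> \<Delta>" for \<Gamma> \<Delta>
  proof -
    have mcs: "mcs S \<Gamma>" "mcs S \<Delta>" using that by (auto simp: canR_def)
    have "A \<in> \<Gamma>" if t: "Just t A \<in> \<Delta>" for t A
    proof (rule ccontr)
      assume "A \<notin> \<Gamma>"
      then have "JNeg A \<in> \<Gamma>" using neg[OF mcs(1)] lang[OF mcs(2) t] by auto
      then have "Just (BarQ t) (JNeg (Just t A)) \<in> \<Gamma>"
        using ax[OF mcs(1) jscheme.jB] lang[OF mcs(2) t] \<open>AxB \<in> S\<close> by auto
      then have "JNeg (Just t A) \<in> \<Delta>" using \<open>canR S \<Gamma> \<Delta>\<close> by (auto simp: canR_def)
      then show False using neg[OF mcs(2)] lang[OF mcs(2) t] t by auto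
    qed
    then show ?thesis using mcs by (auto simp: canR_def)
  qed
  have Five: "canR S \<Delta> \<Theta>" if "Ax5 \<in> S" "canR S \<Gamma> \<Delta>" "canR S \<Gamma> \<Theta>" for \<Gamma> \<Delta> \<Theta>
  proof -
    have mcs: "mcs S \<Gamma>" "mcs S \<Delta>" "mcs S \<Theta>" using that by (auto simp: canR_def)
    have "A \<in> \<Theta>" if t: "Just t A \<in> \<Delta>" for t A
    proof -
      have "Just t A \<in> \<Gamma>"
      proof (rule ccontr)
        assume "Just t A \<notin> \<Gamma>"
        then have "JNeg (Just t A) \<in> \<Gamma>" using neg[OF mcs(1)] lang[OF mcs(2) t] by auto
        then have "Just (Quest t) (JNeg (Just t A)) \<in> \<Gamma>"
          using ax[OF mcs(1) jscheme.j5] lang[OF mcs(2) t] \<open>Ax5 \<in> S\<close> by auto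
        then have "JNeg (Just t A) \<in> \<Delta>" using \<open>canR S \<Gamma> \<Delta>\<close> by (auto simp: canR_def)
        then show False using neg[OF mcs(2)] lang[OF mcs(2) t] t by auto
      qed
      then show ?thesis using \<open>canR S \<Gamma> \<Theta>\<close> by (auto simp: canR_def)
    qed
    then show ?thesis using mcs by (auto simp: canR_def)
  qed
  show ?thesis
  proof
    show "canR S \<Gamma> \<Delta> \<Longrightarrow> \<Gamma> \<in> {\<Gamma>. mcs S \<Gamma>} \<and> \<Delta> \<in> {\<Gamma>. mcs S \<Gamma>}" for \<Gamma> \<Delta>
      by (simp add: canR_def)
    show "AxT \<in> S \<Longrightarrow> \<Gamma> \<in> {\<Gamma>. mcs S \<Gamma>} \<Longrightarrow> canR S \<Gamma> \<Gamma>" for \<Gamma> using T by simp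
    show "AxD \<in> S \<Longrightarrow> \<Gamma> \<in> {\<Gamma>. mcs S \<Gamma>} \<Longrightarrow> \<exists>\<Delta>. canR S \<Gamma> \<Delta>" for \<Gamma> using D by simp
  qed (fact Four B Five)+
qed


section \<open>Quasi-realizations\<close>

primrec boxes :: "mfml \<Rightarrow> nat" where
  "boxes (MVar p) = 0"
| "boxes MBot = 0"
| "boxes (MNeg A) = boxes A"
| "boxes (MAnd A B) = boxes A + boxes B"
| "boxes (MOr A B) = boxes A + boxes B"
| "boxes (MImp A B) = boxes A + boxes B"
| "boxes (Box A) = Suc (boxes A)"

text \<open>The boxes of \<open>A\<close> are numbered from left to right, starting with \<open>n\<close>, and \<open>b\<close> is the sign with
  which \<open>A\<close> occurs in the whole formula. A negative box becomes the variable with its number. A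
  positive box becomes an arbitrary term, and the formula below it may split into a finite
  disjunction of quasi-realizations: in the canonical model, a successor at which all \<open>U\<^sub>i\<close> fail
  together can be found only when every \<open>t:(U\<^sub>1 \<or> \<dots> \<or> U\<^sub>k)\<close> fails, and not merely every \<open>t:U\<^sub>i\<close>.\<close>

primrec quasi :: "scheme set \<Rightarrow> mfml \<Rightarrow> bool \<Rightarrow> nat \<Rightarrow> jfml set" where
  "quasi S (MVar p) b n = {JVar p}"
| "quasi S MBot b n = {JBot}"
| "quasi S (MNeg A) b n = JNeg ` quasi S A (\<not> b) n"
| "quasi S (MAnd A B) b n = (\<lambda>(U, V). JAnd U V) ` (quasi S A b n \<times> quasi S B b (n + boxes A))"
| "quasi S (MOr A B) b n = (\<lambda>(U, V). JOr U V) ` (quasi S A b n \<times> quasi S B b (n + boxes A))"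
| "quasi S (MImp A B) b n = (\<lambda>(U, V). JImp U V) ` (quasi S A (\<not> b) n \<times> quasi S B b (n + boxes A))"
| "quasi S (Box A) b n =
    (if b then (\<lambda>(t, Us). Just t (disj Us)) ` ({t. trm_of S t} \<times> lists (quasi S A b (Suc n)))
     else Just (TVar n) ` quasi S A b (Suc n))"

lemma quasi_nonempty: "quasi S A b n \<noteq> {}"
proof (induction A arbitrary: b n)
  case (Box A)
  have "trm_of S (TConst 0)" by simp
  then show ?case using Box by (auto simp del: trm_of.simps)
qed auto

lemma quasi_jfml_of: "U \<in> quasi S A b n \<Longrightarrow> jfml_of S U"
  by (induction A arbitrary: U b n) (fastforce split: if_splits)+

lemma quasi_jsubst:
  assumes "\<And>i. trm_of S (\<sigma> i)" and "\<And>i. i \<in> {n..<n + boxes A} \<Longrightarrow> \<sigma> i = TVar i"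
    and "U \<in> quasi S A b n"
  shows "jsubst \<sigma> U \<in> quasi S A b n"
  using assms(2,3)
proof (induction A arbitrary: U b n)
  case (Box A)
  have IH: "jsubst \<sigma> U \<in> quasi S A b (Suc n)" if "U \<in> quasi S A b (Suc n)" for U b
    using Box.prems(1) that by (intro Box.IH) auto
  show ?case
  proof (cases b)
    case True
    then obtain t Us where U: "U = Just t (disj Us)" "trm_of S t" "Us \<in> lists (quasi S A b (Suc n))"
      using Box.prems(2) by auto
    then have "jsubst \<sigma> U = Just (tsubst \<sigma> t) (disj (map (jsubst \<sigma>) Us))"
      by (simp add: jsubst_disj)
    moreover have "map (jsubst \<sigma>) Us \<in> lists (quasi S A b (Suc n))" using U(3) IH by auto
    ultimately show ?thesis using True U(2) assms(1) by (auto simp: trm_of_tsubst)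
  next
    case False
    then show ?thesis using Box.prems IH by auto
  qed
next
  case (MAnd A B)
  then show ?case by fastforce
next
  case (MOr A B)
  then show ?case by fastforce
next
  case (MImp A B)
  then show ?case by fastforce
qed auto

text \<open>Quantifying over all quasi-realizations at once is what makes the binary connectives work. In
  the first claim for \<open>A \<longrightarrow> B\<close>, every \<open>U \<longrightarrow> V\<close> holds; so either all \<open>U\<close> fail, and \<open>A\<close> is
  false, or some \<open>U\<close> holds, then all \<open>V\<close> do, and \<open>B\<close> is true. The first claim for a box is immediate
  from the definition of accessibility, the second one is \<open>canR_witness\<close>.\<close>

lemma truth_lemma:
  assumes "mcs S \<Gamma>"
  shows "quasi S A False n \<subseteq> \<Gamma> \<Longrightarrow> forces (canR S) (\<lambda>\<Gamma> p. JVar p \<in> \<Gamma>) \<Gamma> A"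
    and "quasi S A True n \<inter> \<Gamma> = {} \<Longrightarrow> \<not> forces (canR S) (\<lambda>\<Gamma> p. JVar p \<in> \<Gamma>) \<Gamma> A"
  using assms
proof (induction A arbitrary: \<Gamma> n)
  case (MVar p)
  { case 1 then show ?case by auto next case 2 then show ?case by auto }
next
  case MBot
  { case 1 then show ?case by (auto simp: mcs_def) next case 2 then show ?case by auto }
next
  case (MNeg A)
  { case 1
    then have "quasi S A True n \<inter> \<Gamma> = {}"
      using mcs_connectives(1)[OF 1(2)] quasi_jfml_of[of _ S A True n] by auto
    then show ?case using MNeg(2)[OF _ 1(2)] by auto
  next
    case 2
    then have "quasi S A False n \<subseteq> \<Gamma>"
      using mcs_connectives(1)[OF 2(2)] quasi_jfml_of[of _ S A False n] by auto
    then show ?case using MNeg(1)[OF _ 2(2)] by auto }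
next
  case (MAnd A B)
  { case 1
    have "U \<in> \<Gamma> \<and> V \<in> \<Gamma>" if "U \<in> quasi S A False n" "V \<in> quasi S B False (n + boxes A)" for U V
    proof -
      have "JAnd U V \<in> \<Gamma>" using 1(1) that by force
      then show ?thesis
        using mcs_connectives(2)[OF 1(2)] that[THEN quasi_jfml_of] by simp
    qed
    then have "quasi S A False n \<subseteq> \<Gamma>" "quasi S B False (n + boxes A) \<subseteq> \<Gamma>"
      using quasi_nonempty by blast+
    then show ?case using MAnd(1,3)[OF _ 1(2)] by auto
  next
    case 2
    have "U \<notin> \<Gamma> \<or> V \<notin> \<Gamma>" if "U \<in> quasi S A True n" "V \<in> quasi S B True (n + boxes A)" for U V
    proof -
      have "JAnd U V \<notin> \<Gamma>" using 2(1) that by force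
      then show ?thesis
        using mcs_connectives(2)[OF 2(2)] that[THEN quasi_jfml_of] by simp
    qed
    then have "quasi S A True n \<inter> \<Gamma> = {} \<or> quasi S B True (n + boxes A) \<inter> \<Gamma> = {}" by blast
    then show ?case using MAnd(2,4)[OF _ 2(2)] by auto }
next
  case (MOr A B)
  { case 1
    have "U \<in> \<Gamma> \<or> V \<in> \<Gamma>" if "U \<in> quasi S A False n" "V \<in> quasi S B False (n + boxes A)" for U V
    proof -
      have "JOr U V \<in> \<Gamma>" using 1(1) that by force
      then show ?thesis
        using mcs_connectives(3)[OF 1(2)] that[THEN quasi_jfml_of] by simp
    qed
    then have "quasi S A False n \<subseteq> \<Gamma> \<or> quasi S B False (n + boxes A) \<subseteq> \<Gamma>" by blast
    then show ?case using MOr(1,3)[OF _ 1(2)] by auto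
  next
    case 2
    have "U \<notin> \<Gamma> \<and> V \<notin> \<Gamma>" if "U \<in> quasi S A True n" "V \<in> quasi S B True (n + boxes A)" for U V
    proof -
      have "JOr U V \<notin> \<Gamma>" using 2(1) that by force
      then show ?thesis
        using mcs_connectives(3)[OF 2(2)] that[THEN quasi_jfml_of] by simp
    qed
    then have "quasi S A True n \<inter> \<Gamma> = {}" "quasi S B True (n + boxes A) \<inter> \<Gamma> = {}"
      using quasi_nonempty by blast+
    then show ?case using MOr(2,4)[OF _ 2(2)] by auto }
next
  case (MImp A B)
  { case 1
    have "U \<notin> \<Gamma> \<or> V \<in> \<Gamma>" if "U \<in> quasi S A True n" "V \<in> quasi S B False (n + boxes A)" for U V
    proof -
      have "JImp U V \<in> \<Gamma>" using 1(1) that by force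
      then show ?thesis
        using mcs_connectives(4)[OF 1(2)] that[THEN quasi_jfml_of] by simp
    qed
    then have "quasi S A True n \<inter> \<Gamma> = {} \<or> quasi S B False (n + boxes A) \<subseteq> \<Gamma>" by blast
    then show ?case using MImp(2,3)[OF _ 1(2)] by auto
  next
    case 2
    have "U \<in> \<Gamma> \<and> V \<notin> \<Gamma>" if "U \<in> quasi S A False n" "V \<in> quasi S B True (n + boxes A)" for U V
    proof -
      have "JImp U V \<notin> \<Gamma>" using 2(1) that by force
      then show ?thesis
        using mcs_connectives(4)[OF 2(2)] that[THEN quasi_jfml_of] by simp
    qed
    then have "quasi S A False n \<subseteq> \<Gamma>" "quasi S B True (n + boxes A) \<inter> \<Gamma> = {}"
      using quasi_nonempty by blast+
    then show ?case using MImp(1,4)[OF _ 2(2)] by auto }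
next
  case (Box A)
  { case 1
    then have "quasi S A False (Suc n) \<subseteq> \<Delta> \<and> mcs S \<Delta>" if "canR S \<Gamma> \<Delta>" for \<Delta>
      using that by (auto simp: canR_def)
    then have "forces (canR S) (\<lambda>\<Gamma> p. JVar p \<in> \<Gamma>) \<Delta> A" if "canR S \<Gamma> \<Delta>" for \<Delta>
      using Box(1)[of "Suc n" \<Delta>] that by blast
    then show ?case by simp
  next
    case 2
    have "Just t (disj Us) \<notin> \<Gamma>" if "Us \<in> lists (quasi S A True (Suc n))" for t Us
    proof
      assume "Just t (disj Us) \<in> \<Gamma>"
      moreover from this have "trm_of S t"
        using jtheoryD(2)[of S \<Gamma> "Just t (disj Us)"] 2(2) by (simp add: mcs_def)
      ultimately show False using 2(1) that by force
    qed
    then obtain \<Delta> where "canR S \<Gamma> \<Delta>" "\<Delta> \<inter> quasi S A True (Suc n) = {}"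
      using canR_witness[OF 2(2), of "quasi S A True (Suc n)"] quasi_jfml_of by blast
    then show ?case using Box(2)[of "Suc n" \<Delta>] by (auto simp: canR_def) }
qed

lemma provable_quasi_disjunction:
  assumes "matches L M" and "F \<in> ModL M"
  shows "\<exists>Us \<in> lists (quasi L F True 0). disj Us \<in> JustL L"
proof (rule ccontr)
  assume "\<not> ?thesis"
  then obtain \<Gamma> where \<Gamma>: "mcs L \<Gamma>" "\<Gamma> \<inter> quasi L F True 0 = {}"
    using separating_mcs[OF jtheory_JustL, of "quasi L F True 0" L] quasi_jfml_of by blast
  have "forces (canR L) (\<lambda>\<Gamma> p. JVar p \<in> \<Gamma>) \<Gamma> F"
    using frame.soundness[OF frame.matches_frame[OF canonical_frame assms(1)] assms(2)] \<Gamma>(1) by simp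
  then show False using truth_lemma(2)[OF \<Gamma>(1), of F 0] \<Gamma>(2) by (simp add: Int_commute)
qed


section \<open>Condensing quasi-realizations\<close>

lemma realization_forget: "realization S A G \<Longrightarrow> forget G = A"
  by (induction rule: realization.induct) auto

lemma realization_jfml_of: "realization S A G \<Longrightarrow> jfml_of S G"
  by (induction rule: realization.induct) auto

lemma realization_jsubst:
  "realization S A G \<Longrightarrow> (\<And>i. trm_of S (\<sigma> i)) \<Longrightarrow> realization S A (jsubst \<sigma> G)"
  by (induction rule: realization.induct) (auto intro: realization.intros trm_of_tsubst)

lemma occ_terms_jsubst: "occ_terms b (jsubst \<sigma> G) = map (tsubst \<sigma>) (occ_terms b G)"
  by (induction G arbitrary: b) auto

lemma occ_terms_jsubst_id:
  assumes "set (occ_terms b G) \<subseteq> TVar ` I" and "\<And>i. i \<in> I \<Longrightarrow> \<sigma> i = TVar i"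
  shows "occ_terms b (jsubst \<sigma> G) = occ_terms b G"
  using assms unfolding occ_terms_jsubst by (intro map_idI) auto

text \<open>In a positive position the realization must be weaker than what it replaces, in a negative
  position stronger.\<close>

definition toward :: "bool \<Rightarrow> jfml \<Rightarrow> jfml \<Rightarrow> jfml" where
  "toward b U G = (if b then JImp U G else JImp G U)"

text \<open>The substitution \<open>\<sigma>\<close> moves only variables that stand for boxes of \<open>A\<close>, so that it
  neither destroys normality outside \<open>A\<close> nor leaves the quasi-realizations of other subformulas.\<close>

definition condenses ::
  "scheme set \<Rightarrow> mfml \<Rightarrow> bool \<Rightarrow> nat \<Rightarrow> jfml set \<Rightarrow> (nat \<Rightarrow> trm) \<Rightarrow> jfml \<Rightarrow> bool" where
  "condenses S A b n Q \<sigma> G \<longleftrightarrow>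
    (\<forall>i. trm_of S (\<sigma> i)) \<and> (\<forall>i. i \<notin> {n..<n + boxes A} \<longrightarrow> \<sigma> i = TVar i) \<and>
    realization S A G \<and> distinct (occ_terms (\<not> b) G) \<and>
    set (occ_terms (\<not> b) G) \<subseteq> TVar ` {n..<n + boxes A} \<and>
    (\<forall>U \<in> Q. toward b (jsubst \<sigma> U) G \<in> JustL S)"

lemma toward_jsubst:
  "(\<And>i. trm_of S (\<sigma> i)) \<Longrightarrow> toward b U G \<in> JustL S \<Longrightarrow> toward b (jsubst \<sigma> U) (jsubst \<sigma> G) \<in> JustL S"
  using JustL_jsubst[of S \<sigma> "toward b U G"] by (simp add: toward_def split: if_splits)

text \<open>The terms substituted for variables of \<open>A\<close> may contain variables of \<open>B\<close>, so the components are
  condensed one after the other. First \<open>A\<close> is condensed, with substitution \<open>\<sigma>\<close>, then \<open>\<sigma>\<close> is applied to the second components before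
  they are condensed, with substitution \<open>\<tau>\<close>. The variables of \<open>A\<close> and \<open>B\<close> being disjoint, these stay
  quasi-realizations of \<open>B\<close> under \<open>\<sigma>\<close>, and the realization of \<open>A\<close> stays normal under \<open>\<tau>\<close>.\<close>

lemma condense_pair:
  assumes A: "\<And>Q. finite Q \<Longrightarrow> Q \<subseteq> quasi S A a n \<Longrightarrow> \<exists>\<sigma> G. condenses S A a n Q \<sigma> G"
    and B: "\<And>Q. finite Q \<Longrightarrow> Q \<subseteq> quasi S B b (n + boxes A) \<Longrightarrow>
      \<exists>\<sigma> G. condenses S B b (n + boxes A) Q \<sigma> G"
    and P: "finite P" "P \<subseteq> quasi S A a n \<times> quasi S B b (n + boxes A)"
  shows "\<exists>\<sigma> G H. (\<forall>i. trm_of S (\<sigma> i)) \<and>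
    (\<forall>i. i \<notin> {n..<n + (boxes A + boxes B)} \<longrightarrow> \<sigma> i = TVar i) \<and>
    realization S A G \<and> realization S B H \<and>
    distinct (occ_terms (\<not> a) G @ occ_terms (\<not> b) H) \<and>
    set (occ_terms (\<not> a) G @ occ_terms (\<not> b) H) \<subseteq> TVar ` {n..<n + (boxes A + boxes B)} \<and>
    (\<forall>(U, V) \<in> P. toward a (jsubst \<sigma> U) G \<in> JustL S \<and> toward b (jsubst \<sigma> V) H \<in> JustL S)"
proof -
  have "finite (fst ` P)" "fst ` P \<subseteq> quasi S A a n" using P by auto
  then obtain \<sigma> G where "condenses S A a n (fst ` P) \<sigma> G" using A by blast
  then have \<sigma>: "\<And>i. trm_of S (\<sigma> i)" "\<And>i. i \<notin> {n..<n + boxes A} \<Longrightarrow> \<sigma> i = TVar i"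
    and G: "realization S A G" "distinct (occ_terms (\<not> a) G)"
      "set (occ_terms (\<not> a) G) \<subseteq> TVar ` {n..<n + boxes A}"
      "\<And>U. U \<in> fst ` P \<Longrightarrow> toward a (jsubst \<sigma> U) G \<in> JustL S"
    by (auto simp: condenses_def)
  have "finite (jsubst \<sigma> ` snd ` P)" "jsubst \<sigma> ` snd ` P \<subseteq> quasi S B b (n + boxes A)"
    using P \<sigma> by (auto intro!: quasi_jsubst)
  then obtain \<tau> H where "condenses S B b (n + boxes A) (jsubst \<sigma> ` snd ` P) \<tau> H" using B by blast
  then have \<tau>: "\<And>i. trm_of S (\<tau> i)"
      "\<And>i. i \<notin> {n + boxes A..<n + boxes A + boxes B} \<Longrightarrow> \<tau> i = TVar i"
    and H: "realization S B H" "distinct (occ_terms (\<not> b) H)"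
      "set (occ_terms (\<not> b) H) \<subseteq> TVar ` {n + boxes A..<n + boxes A + boxes B}"
      "\<And>V. V \<in> snd ` P \<Longrightarrow> toward b (jsubst \<tau> (jsubst \<sigma> V)) H \<in> JustL S"
    by (auto simp: condenses_def)
  let ?\<rho> = "\<lambda>i. tsubst \<tau> (\<sigma> i)"
  have occ: "occ_terms (\<not> a) (jsubst \<tau> G) = occ_terms (\<not> a) G"
    using G(3) \<tau>(2) by (intro occ_terms_jsubst_id) auto
  have "toward a (jsubst ?\<rho> U) (jsubst \<tau> G) \<in> JustL S" if "(U, V) \<in> P" for U V
    using toward_jsubst[OF \<tau>(1) G(4)[of U]] that by (force simp: jsubst_comp)
  moreover have "toward b (jsubst ?\<rho> V) H \<in> JustL S" if "(U, V) \<in> P" for U V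
    using H(4)[of V] that by (force simp: jsubst_comp)
  moreover have "distinct (occ_terms (\<not> a) (jsubst \<tau> G) @ occ_terms (\<not> b) H)"
    using G(2,3) H(2,3) by (force simp: occ)
  moreover have "set (occ_terms (\<not> a) (jsubst \<tau> G) @ occ_terms (\<not> b) H)
      \<subseteq> TVar ` {n..<n + (boxes A + boxes B)}"
    using G(3) H(3) by (force simp: occ)
  ultimately show ?thesis
    using \<sigma> \<tau> realization_jsubst[OF G(1) \<tau>(1)] H(1)
    by (intro exI[of _ ?\<rho>] exI[of _ "jsubst \<tau> G"] exI[of _ H]) (auto intro: trm_of_tsubst)
qed

text \<open>The binary connectives, here \<open>j\<close>, enter the merging only through monotonicity: \<open>b\<close> is the sign of
  the compound and of its second argument, and \<open>a\<close>, the sign of the first argument, is opposite to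
  \<open>b\<close> exactly for implication.\<close>

lemma condense_binary:
  assumes A: "\<And>Q. finite Q \<Longrightarrow> Q \<subseteq> quasi S A a n \<Longrightarrow> \<exists>\<sigma> G. condenses S A a n Q \<sigma> G"
    and B: "\<And>Q. finite Q \<Longrightarrow> Q \<subseteq> quasi S B b (n + boxes A) \<Longrightarrow>
      \<exists>\<sigma> G. condenses S B b (n + boxes A) Q \<sigma> G"
    and Q: "finite Q" "Q \<subseteq> (\<lambda>(U, V). j U V) ` (quasi S A a n \<times> quasi S B b (n + boxes A))"
    and boxes: "boxes C = boxes A + boxes B"
    and subst: "\<And>\<sigma> U V. jsubst \<sigma> (j U V) = j (jsubst \<sigma> U) (jsubst \<sigma> V)"
    and real: "\<And>G H. realization S A G \<Longrightarrow> realization S B H \<Longrightarrow> realization S C (j G H)"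
    and occ: "\<And>G H. occ_terms (\<not> b) (j G H) = occ_terms (\<not> a) G @ occ_terms (\<not> b) H"
    and lang: "\<And>G H. jfml_of S (j G H) \<longleftrightarrow> jfml_of S G \<and> jfml_of S H"
    and mono: "\<And>v G H U V. jeval v (toward a U G) \<Longrightarrow> jeval v (toward b V H) \<Longrightarrow>
      jeval v (toward b (j U V) (j G H))"
  shows "\<exists>\<sigma> G. condenses S C b n Q \<sigma> G"
proof -
  obtain P where P: "finite P" "P \<subseteq> quasi S A a n \<times> quasi S B b (n + boxes A)"
    and QP: "Q = (\<lambda>(U, V). j U V) ` P"
    using finite_subset_image[OF Q] by blast
  obtain \<sigma> G H where \<sigma>: "\<forall>i. trm_of S (\<sigma> i)"
      "\<forall>i. i \<notin> {n..<n + (boxes A + boxes B)} \<longrightarrow> \<sigma> i = TVar i"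
    and GH: "realization S A G" "realization S B H"
      "distinct (occ_terms (\<not> a) G @ occ_terms (\<not> b) H)"
      "set (occ_terms (\<not> a) G @ occ_terms (\<not> b) H) \<subseteq> TVar ` {n..<n + (boxes A + boxes B)}"
    and pr: "\<forall>(U, V) \<in> P. toward a (jsubst \<sigma> U) G \<in> JustL S \<and> toward b (jsubst \<sigma> V) H \<in> JustL S"
    using condense_pair[OF A B P] by blast
  have "toward b (j (jsubst \<sigma> U) (jsubst \<sigma> V)) (j G H) \<in> JustL S" if "(U, V) \<in> P" for U V
  proof -
    have th: "toward a (jsubst \<sigma> U) G \<in> JustL S" "toward b (jsubst \<sigma> V) H \<in> JustL S"
      using pr that by auto
    then have "jfml_of S (toward b (j (jsubst \<sigma> U) (jsubst \<sigma> V)) (j G H))"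
      by (auto dest!: JustL_jfml_of simp: toward_def lang split: if_splits)
    then show ?thesis
      by (rule JustL_conseq[where As = "[toward a (jsubst \<sigma> U) G, toward b (jsubst \<sigma> V) H]"])
        (use th in \<open>auto intro: mono\<close>)
  qed
  then have "condenses S C b n Q \<sigma> (j G H)"
    using \<sigma> GH real by (auto simp: condenses_def QP boxes occ subst)
  then show ?thesis by blast
qed

text \<open>For a negative box, the variable \<open>v\<close> of the realization \<open>v:G\<close> must yield evidence for each member
  \<open>U\<close> of the finite set, where \<open>s:(G \<longrightarrow> U)\<close> is provable for one ground term \<open>s\<close>. So \<open>v\<close> is replaced
  by \<open>s\<cdot>v\<close> in the quasi-realizations; groundness makes \<open>s\<close> survive this very substitution. For a
  positive box, the evidence for the given disjunctions is brought to \<open>G\<close> by application, and the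
  resulting terms are added up.\<close>

lemma condensing:
  assumes "finite Q" and "Q \<subseteq> quasi S A b n"
  shows "\<exists>\<sigma> G. condenses S A b n Q \<sigma> G"
  using assms
proof (induction A arbitrary: b n Q)
  case (MVar p)
  have "JImp (JVar p) (JVar p) \<in> JustL S" by (rule JustL_conseq[where As = "[]"]) auto
  then have "condenses S (MVar p) b n Q TVar (JVar p)"
    using MVar.prems by (auto simp: condenses_def toward_def intro: realization.intros)
  then show ?case by blast
next
  case MBot
  have "JImp JBot JBot \<in> JustL S" by (rule JustL_conseq[where As = "[]"]) auto
  then have "condenses S MBot b n Q TVar JBot"
    using MBot.prems by (auto simp: condenses_def toward_def intro: realization.intros)
  then show ?case by blast
next
  case (MNeg A)
  have "Q \<subseteq> JNeg ` quasi S A (\<not> b) n" using MNeg.prems(2) by simp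
  then obtain P where P: "finite P" "P \<subseteq> quasi S A (\<not> b) n" "Q = JNeg ` P"
    using finite_subset_image[OF MNeg.prems(1)] by metis
  then obtain \<sigma> G where c: "condenses S A (\<not> b) n P \<sigma> G" using MNeg.IH by blast
  have "toward b (JNeg (jsubst \<sigma> U)) (JNeg G) \<in> JustL S" if "U \<in> P" for U
  proof -
    have th: "toward (\<not> b) (jsubst \<sigma> U) G \<in> JustL S" using c that by (auto simp: condenses_def)
    then have "jfml_of S (toward b (JNeg (jsubst \<sigma> U)) (JNeg G))"
      by (auto dest!: JustL_jfml_of simp: toward_def split: if_splits)
    then show ?thesis
      by (rule JustL_conseq[where As = "[toward (\<not> b) (jsubst \<sigma> U) G]"])
        (use th in \<open>auto simp: toward_def split: if_splits\<close>)
  qed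
  then have "condenses S (MNeg A) b n Q \<sigma> (JNeg G)"
    using c P(3) by (auto simp: condenses_def intro: realization.intros)
  then show ?case by blast
next
  case (MAnd A B)
  show ?case
    by (rule condense_binary[OF MAnd.IH MAnd.prems(1), where j = JAnd], assumption+,
        use MAnd.prems(2) in simp)
      (auto simp: toward_def intro: realization.intros)
next
  case (MOr A B)
  show ?case
    by (rule condense_binary[OF MOr.IH MOr.prems(1), where j = JOr], assumption+,
        use MOr.prems(2) in simp)
      (auto simp: toward_def intro: realization.intros)
next
  case (MImp A B)
  show ?case
    by (rule condense_binary[OF MImp.IH MImp.prems(1), where j = JImp], assumption+,
        use MImp.prems(2) in simp)
      (auto simp: toward_def intro: realization.intros)
next
  case (Box A)
  show ?case
  proof (cases b)
    case True
    then have "Q \<subseteq> (\<lambda>(t, Us). Just t (disj Us)) ` ({t. trm_of S t} \<times> lists (quasi S A True (Suc n)))"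
      using Box.prems(2) by simp
    then obtain P where P: "finite P" "P \<subseteq> {t. trm_of S t} \<times> lists (quasi S A True (Suc n))"
      and QP: "Q = (\<lambda>(t, Us). Just t (disj Us)) ` P"
      using finite_subset_image[OF Box.prems(1)] by metis
    (* All disjuncts of all members of Q are condensed together, so that a single G serves them all. *)
    let ?X = "\<Union>(t, Us) \<in> P. set Us"
    have "finite ?X" "?X \<subseteq> quasi S A True (Suc n)" using P by auto
    then obtain \<sigma> G where "condenses S A True (Suc n) ?X \<sigma> G" using Box.IH by blast
    then have \<sigma>: "\<And>i. trm_of S (\<sigma> i)" "\<And>i. i \<notin> {Suc n..<Suc n + boxes A} \<Longrightarrow> \<sigma> i = TVar i"
      and G: "realization S A G" "distinct (occ_terms False G)"
        "set (occ_terms False G) \<subseteq> TVar ` {Suc n..<Suc n + boxes A}"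
        "\<And>U. U \<in> ?X \<Longrightarrow> JImp (jsubst \<sigma> U) G \<in> JustL S"
      by (auto simp: condenses_def toward_def)
    have lG: "jfml_of S G" by (rule realization_jfml_of[OF G(1)])
    let ?D = "\<lambda>Us. disj (map (jsubst \<sigma>) Us)"
    have lD: "jfml_of S (?D Us)" "trm_of S (tsubst \<sigma> t)" if "(t, Us) \<in> P" for t Us
      using that P(2) quasi_jfml_of \<sigma>(1) by (fastforce intro!: jfml_of_jsubst trm_of_tsubst)+
    have "JImp (?D Us) G \<in> JustL S" if "(t, Us) \<in> P" for t Us
    proof (rule JustL_conseq[where As = "map (\<lambda>U. JImp (jsubst \<sigma> U) G) Us"])
      show "jfml_of S (JImp (?D Us) G)" using lD[OF that] lG by simp
      show "set (map (\<lambda>U. JImp (jsubst \<sigma> U) G) Us) \<subseteq> JustL S" using that G(4) by auto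
    qed auto
    then obtain s where s: "trm_of S s" "\<And>t Us. (t, Us) \<in> P \<Longrightarrow> Just s (JImp (?D Us) G) \<in> JustL S"
      using uniform_internalization[of "(\<lambda>(t, Us). JImp (?D Us) G) ` P" S] P(1) by fastforce
    obtain u where u: "trm_of S u"
      "\<And>t Us. (t, Us) \<in> P \<Longrightarrow> JImp (Just (App s (tsubst \<sigma> t)) G) (Just u G) \<in> JustL S"
      using common_upper_term[of "(\<lambda>(t, Us). App s (tsubst \<sigma> t)) ` P" S] P(1) s(1) lD(2) lG
      by fastforce
    have "JImp (Just (tsubst \<sigma> t) (?D Us)) (Just u G) \<in> JustL S" if "(t, Us) \<in> P" for t Us
      using JustL_app[OF s(2)[OF that] lD(2)[OF that] lD(1)[OF that]] u(2)[OF that]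
        lD[OF that] u(1) lG
      by (intro JustL_conseq[where As = "[JImp (Just (tsubst \<sigma> t) (?D Us)) (Just (App s (tsubst \<sigma> t)) G),
            JImp (Just (App s (tsubst \<sigma> t)) G) (Just u G)]"]) auto
    then have "condenses S (Box A) b n Q \<sigma> (Just u G)"
      using True \<sigma> G(1-3) u(1) unfolding condenses_def
      by (force simp: QP toward_def jsubst_disj intro: realization.intros)
    then show ?thesis by blast
  next
    case False
    then have "Q \<subseteq> Just (TVar n) ` quasi S A False (Suc n)" using Box.prems(2) by simp
    then obtain P where P: "finite P" "P \<subseteq> quasi S A False (Suc n)" "Q = Just (TVar n) ` P"
      using finite_subset_image[OF Box.prems(1)] by metis
    then obtain \<sigma> G where "condenses S A False (Suc n) P \<sigma> G" using Box.IH by blast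
    then have \<sigma>: "\<And>i. trm_of S (\<sigma> i)" "\<And>i. i \<notin> {Suc n..<Suc n + boxes A} \<Longrightarrow> \<sigma> i = TVar i"
      and G: "realization S A G" "distinct (occ_terms True G)"
        "set (occ_terms True G) \<subseteq> TVar ` {Suc n..<Suc n + boxes A}"
        "\<And>U. U \<in> P \<Longrightarrow> JImp G (jsubst \<sigma> U) \<in> JustL S"
      by (auto simp: condenses_def toward_def)
    obtain s where s: "trm_of S s" "\<And>\<tau>. tsubst \<tau> s = s"
      "\<And>U. U \<in> P \<Longrightarrow> Just s (JImp G (jsubst \<sigma> U)) \<in> JustL S"
      using uniform_internalization[of "(\<lambda>U. JImp G (jsubst \<sigma> U)) ` P" S] P(1) G(4) by fastforce
    define \<tau> where "\<tau> = TVar(n := App s (TVar n))"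
    let ?\<rho> = "\<lambda>i. tsubst \<tau> (\<sigma> i)"
    have \<tau>: "\<And>i. trm_of S (\<tau> i)" and [simp]: "\<And>i. i \<noteq> n \<Longrightarrow> \<tau> i = TVar i" "\<tau> n = App s (TVar n)"
      using s(1) by (auto simp: \<tau>_def)
    have rG: "realization S A (jsubst \<tau> G)" by (rule realization_jsubst[OF G(1) \<tau>])
    have occ: "occ_terms True (jsubst \<tau> G) = occ_terms True G"
      by (rule occ_terms_jsubst_id[OF G(3)]) auto
    have "JImp (Just (TVar n) (jsubst \<tau> G)) (jsubst ?\<rho> (Just (TVar n) U)) \<in> JustL S"
      if "U \<in> P" for U
    proof -
      have "Just s (JImp (jsubst \<tau> G) (jsubst ?\<rho> U)) \<in> JustL S"
        using JustL_jsubst[OF \<tau> s(3)[OF that]] by (simp add: jsubst_comp s(2))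
      then have "JImp (Just (TVar n) (jsubst \<tau> G)) (Just (App s (TVar n)) (jsubst ?\<rho> U)) \<in> JustL S"
        using realization_jfml_of[OF rG] by (intro JustL_app) auto
      then show ?thesis using \<sigma>(2)[of n] by simp
    qed
    moreover have "trm_of S (?\<rho> i)" for i using \<sigma>(1) \<tau> by (intro trm_of_tsubst)
    moreover have "?\<rho> i = TVar i" if "i \<notin> {n..<n + boxes (Box A)}" for i
      using that \<sigma>(2)[of i] by auto
    moreover have "realization S (Box A) (Just (TVar n) (jsubst \<tau> G))"
      using rG by (intro realization.intros) auto
    moreover have "set (occ_terms True G) \<subseteq> TVar ` {n..<n + boxes (Box A)}"
      "TVar n \<notin> set (occ_terms True G)" "TVar n \<in> TVar ` {n..<n + boxes (Box A)}"
      using G(3) by auto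
    ultimately have "condenses S (Box A) b n Q ?\<rho> (Just (TVar n) (jsubst \<tau> G))"
      using False G(2) by (simp add: condenses_def P(3) occ toward_def)
    then show ?thesis by blast
  qed
qed


section \<open>Normal realizations and the projection equalities\<close>

theorem normal_realization_theorem:
  assumes "matches L M" and "F \<in> ModL M"
  shows "\<exists>G. normal_realization L F G \<and> G \<in> JustL L"
proof -
  obtain Us where Us: "Us \<in> lists (quasi L F True 0)" "disj Us \<in> JustL L"
    using provable_quasi_disjunction[OF assms] by blast
  then obtain \<sigma> G where c: "condenses L F True 0 (set Us) \<sigma> G"
    using condensing[of "set Us" L F True 0] by auto
  have G: "realization L F G" and imp: "\<And>U. U \<in> set Us \<Longrightarrow> JImp (jsubst \<sigma> U) G \<in> JustL L"
    using c by (auto simp: condenses_def toward_def)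
  have "disj (map (jsubst \<sigma>) Us) \<in> JustL L"
    using JustL_jsubst[OF _ Us(2), of \<sigma>] c by (simp add: condenses_def jsubst_disj)
  then have "G \<in> JustL L"
    using imp realization_jfml_of[OF G]
    by (intro JustL_conseq[where As = "disj (map (jsubst \<sigma>) Us) # map (\<lambda>U. JImp (jsubst \<sigma> U) G) Us"])
      auto
  moreover have "normal_realization L F G"
    using c by (auto simp: condenses_def normal_realization_def normal_def)
  ultimately show ?thesis by blast
qed

corollary forgetful_projection:
  assumes "matches L M"
  shows "forget ` JustL L = ModL M"
proof
  show "forget ` JustL L \<subseteq> ModL M" using forget_JustL[OF assms] by auto
  show "ModL M \<subseteq> forget ` JustL L"
    using normal_realization_theorem[OF assms] realization_forget
    unfolding normal_realization_def by blast
qed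

theorem theorem2p3:
  "(forget ` JustL {} = ModL {} \<and>
    forget ` JustL {AxT} = ModL {AxT} \<and>
    forget ` JustL {AxD} = ModL {AxD} \<and>
    forget ` JustL {Ax4} = ModL {Ax4} \<and>
    forget ` JustL {Ax5} = ModL {Ax5} \<and>
    forget ` JustL {AxD, Ax5} = ModL {AxD, Ax5} \<and>
    forget ` JustL {AxD, Ax4} = ModL {AxD, Ax4} \<and>
    forget ` JustL {Ax4, Ax5} = ModL {Ax4, Ax5} \<and>
    forget ` JustL {AxD, Ax4, Ax5} = ModL {AxD, Ax4, Ax5} \<and>
    forget ` LP = S4 \<and>
    forget ` JustL {AxT, Ax5} = S5 \<and>
    forget ` JustL {AxT, Ax4, Ax5} = S5) \<and>
   (forget ` JustL {AxB} = ModL {AxB} \<and>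
    forget ` JustL {AxT, AxB} = ModL {AxT, AxB} \<and>
    forget ` JustL {AxD, AxB} = ModL {AxD, AxB} \<and>
    forget ` JustL {AxB, Ax4} = ModL {AxB, Ax5} \<and>
    forget ` JustL {AxB, Ax5} = ModL {AxB, Ax5} \<and>
    forget ` JustL {AxB, Ax4, Ax5} = ModL {AxB, Ax5} \<and>
    forget ` JustL {AxT, AxB, Ax5} = S5 \<and>
    forget ` JustL {AxD, AxB, Ax5} = S5 \<and>
    forget ` JustL {AxT, AxB, Ax4, Ax5} = S5 \<and>
    forget ` JustL {AxD, AxB, Ax4, Ax5} = S5 \<and>
    forget ` JustL {AxT, AxB, Ax4} = S5 \<and>
    forget ` JustL {AxD, AxB, Ax4} = S5) \<and>
   (\<forall>(L, M) \<in>
      {({}, ModL {}),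
       ({AxT}, ModL {AxT}),
       ({AxD}, ModL {AxD}),
       ({Ax4}, ModL {Ax4}),
       ({Ax5}, ModL {Ax5}),
       ({AxD, Ax5}, ModL {AxD, Ax5}),
       ({AxD, Ax4}, ModL {AxD, Ax4}),
       ({Ax4, Ax5}, ModL {Ax4, Ax5}),
       ({AxD, Ax4, Ax5}, ModL {AxD, Ax4, Ax5}),
       ({AxT, Ax4}, S4),
       ({AxT, Ax5}, S5),
       ({AxT, Ax4, Ax5}, S5),
       ({AxB}, ModL {AxB}),
       ({AxT, AxB}, ModL {AxT, AxB}),
       ({AxD, AxB}, ModL {AxD, AxB}),
       ({AxB, Ax4}, ModL {AxB, Ax5}),
       ({AxB, Ax5}, ModL {AxB, Ax5}),
       ({AxB, Ax4, Ax5}, ModL {AxB, Ax5}),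
       ({AxT, AxB, Ax5}, S5),
       ({AxD, AxB, Ax5}, S5),
       ({AxT, AxB, Ax4, Ax5}, S5),
       ({AxD, AxB, Ax4, Ax5}, S5),
       ({AxT, AxB, Ax4}, S5),
       ({AxD, AxB, Ax4}, S5)}.
      \<forall>F \<in> M. \<exists>G. normal_realization L F G \<and> G \<in> JustL L)"
proof -
  have projection: "forget ` JustL L = ModL M" if "matches L M" for L M
    using that by (rule forgetful_projection)
  have normal: "\<forall>F \<in> ModL M. \<exists>G. normal_realization L F G \<and> G \<in> JustL L" if "matches L M" for L M
    using normal_realization_theorem[OF that] by blast
  show ?thesis
    (* Expand the quantifier over the finite table of pairs into one conjunct per pair. *)
    unfolding ball_simps(5,7) prod.case
    by (intro conjI TrueI; (rule projection | rule normal); simp add: matches_def)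
qed

end
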